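(* Let $G$ be a semigroup acting on a space $X$, $s:G\times X\to\mathbb R$ an additive cocycle, and $\mu$ a probability measure on $G$. Let $(X_i)_{i\ge1}$ be i.i.d. random variables of law $\mu$, $S_n=X_n\cdots X_1$, and $r(g)=\sup_{x\in X}|s(g,x)|$. Assume that there exists $\tau>0$ such that $\mathbb E\big(\exp(\tau r(X_1))\big)<\infty$. (1) If $\lim_{n\to\infty}\frac1n\sup_{x\in X}\mathbb E(s(S_n,x))<0$, then there exist $\lambda>0$, $\epsilon_0>0$, $n_0\in\mathbb N^*$ such that for every $0<\epsilon<\epsilon_0$ and $n>n_0$, $$\sup_{x\in X}\mathbb E\big[\exp(\epsilon\, s(S_n,x))\big]\le(1-\epsilon\lambda)^n .$$ (2) If $\lim_{n\to\infty}\frac1n\sup_{x\in X}\mathbb E(s(S_n,x))=0$, then for all $\gamma>0$ there exist $\epsilon(\gamma)>0$ and $n(\gamma)\in\mathbb N^*$ such that for every $0<\epsilon<\epsilon(\gamma)$ and $n>n(\gamma)$, $$\sup_{x\in X}\mathbb E\big[\exp(\epsilon\, s(S_n,x))\big]\le(1+\epsilon\gamma)^n .$$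
   Context: An additive cocycle on $G\times X$ is a map $s:G\times X\to\mathbb R$ with $s(g_1g_2,x)=s(g_1,g_2.x)+s(g_2,x)$ for all $g_1,g_2\in G$, $x\in X$. All functions of the random variables appearing ($r(X_1)$, $s(S_n,x)$, etc.) are implicitly assumed measurable. The limits $\lim_n\frac1n\sup_x\mathbb E(s(S_n,x))$ always exist by sub-additivity. *)

theory Defs
  imports "HOL-Probability.Probability"
begin

definition semigroup_action :: "('g::semigroup_mult \<Rightarrow> 'x \<Rightarrow> 'x) \<Rightarrow> bool"
  where "semigroup_action act \<longleftrightarrow> (\<forall>g h x. act (g * h) x = act g (act h x))"

definition additive_cocycle ::
    "('g::semigroup_mult \<Rightarrow> 'x \<Rightarrow> 'x) \<Rightarrow> ('g \<Rightarrow> 'x \<Rightarrow> real) \<Rightarrow> bool"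
  where "additive_cocycle act s \<longleftrightarrow>
    (\<forall>g\<^sub>1 g\<^sub>2 x. s (g\<^sub>1 * g\<^sub>2) x = s g\<^sub>1 (act g\<^sub>2 x) + s g\<^sub>2 x)"

text \<open>The product \<open>g n * \<dots> * g 1\<close>, meaningful only for \<open>n \<ge> 1\<close> because a semigroup need
  not have a unit.\<close>

fun left_prod :: "(nat \<Rightarrow> 'g::semigroup_mult) \<Rightarrow> nat \<Rightarrow> 'g" where
  "left_prod g 0 = undefined"
| "left_prod g (Suc 0) = g 1"
| "left_prod g (Suc (Suc n)) = g (Suc (Suc n)) * left_prod g (Suc n)"

text \<open>\<open>r(g) = sup\<^sub>x |s(g,x)|\<close>, taken in \<open>[0,\<infinity>]\<close>, since \<open>s(g,\<cdot>)\<close> may be unbounded for some \<open>g\<close>.\<close>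

definition cocycle_sup :: "('g \<Rightarrow> 'x \<Rightarrow> real) \<Rightarrow> 'g \<Rightarrow> ennreal"
  where "cocycle_sup s g = (SUP x. ennreal \<bar>s g x\<bar>)"

definition exp_ennreal :: "ennreal \<Rightarrow> ennreal"
  where "exp_ennreal t = (if t = \<infinity> then \<infinity> else ennreal (exp (enn2real t)))"

text \<open>The measurability convention on \<open>s(S\<^sub>n,x)\<close> and \<open>r(X\<^sub>1)\<close>, as functions of the increments:
  \<open>(g\<^sub>1,\<dots>,g\<^sub>n) \<mapsto> s(g\<^sub>n\<cdots>g\<^sub>1,x)\<close> is measurable for the product \<open>\<sigma>\<close>-algebra. Measurability
  of \<open>s(\<cdot>,x)\<close> together with measurability of the multiplication would be more restrictive.\<close>

definition cocycle_measurable ::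
    "'g::semigroup_mult measure \<Rightarrow> ('g \<Rightarrow> 'x \<Rightarrow> real) \<Rightarrow> bool"
  where "cocycle_measurable \<mu> s \<longleftrightarrow>
    cocycle_sup s \<in> borel_measurable \<mu> \<and>
    (\<forall>n\<ge>1. \<forall>x. (\<lambda>g. s (left_prod g n) x) \<in> borel_measurable (\<Pi>\<^sub>M i\<in>{1..n}. \<mu>))"

end

theory Submission imports Defs
begin

text \<open>
  By independence and the cocycle identity, \<open>F n = sup\<^sub>x E \<phi>(s(S\<^sub>n,x))\<close> is submultiplicative in \<open>n\<close>
  whenever \<open>\<phi>(a + b) \<le> \<phi>(a) \<phi>(b)\<close>. For \<open>\<phi>(t) = exp (\<tau>\<bar>t\<bar>)\<close> this gives exponential moments of
  \<open>s(S\<^sub>n,x)\<close> that are uniform in \<open>x\<close>. If \<open>sup\<^sub>x E s(S\<^sub>p,x) < p c\<close> for some \<open>p\<close>, a second-order Taylor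
  expansion of \<open>\<phi>(t) = exp (\<epsilon> t)\<close> then yields \<open>F p \<le> exp (\<epsilon> p b)\<close> with \<open>b < c\<close> for small \<open>\<epsilon>\<close>, and
  submultiplicativity along \<open>n = q p + r\<close> yields \<open>F n \<le> exp (\<epsilon> n c)\<close> for \<open>n\<close> large, uniformly in
  \<open>\<epsilon>\<close> because the factor \<open>F r\<close> is at most \<open>exp (\<epsilon> A)\<close>. Both parts are the case of a \<open>c\<close> slightly
  above the limit.
\<close>

section \<open>Ordered products in a semigroup\<close>

lemma left_prod_cong:
  assumes "n \<ge> 1" and "\<And>i. i \<in> {1..n} \<Longrightarrow> g i = h i"
  shows "left_prod g n = left_prod h n"
  using assms
proof (induction n rule: nat_induct_at_least)
  case base
  then show ?case by simp
next
  case (Suc n)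
  have "left_prod g n = left_prod h n" "g (Suc n) = h (Suc n)"
    using Suc by auto
  then show ?case using Suc.hyps by (cases n) auto
qed

lemma left_prod_add:
  assumes "m \<ge> 1" "n \<ge> 1"
  shows "left_prod g (m + n) = left_prod (\<lambda>i. g (m + i)) n * left_prod g m"
  using assms(2)
proof (induction n rule: nat_induct_at_least)
  case base
  then show ?case using assms(1) by (cases m) auto
next
  case (Suc n)
  obtain k where k: "n = Suc k" using Suc.hyps by (cases n) auto
  have "left_prod g (m + Suc n) = g (m + Suc n) * left_prod g (m + n)"
    using assms(1) k by simp
  then show ?case using Suc.IH k by (simp add: mult.assoc)
qed

text \<open>The defining equation is stated for \<open>Suc 0\<close> and cannot fire on
  \<open>1\<close> once \<open>One_nat_def\<close> leaves the simpset.\<close>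

lemma left_prod_1 [simp]: "left_prod g 1 = g 1"
  by simp

\<comment> \<open>Otherwise the simplifier turns the index set \<open>{1..n}\<close> into \<open>{Suc 0..n}\<close>, and measurability
  facts stated for the former no longer apply.\<close>
declare One_nat_def [simp del]

section \<open>Elementary bounds for the exponential\<close>

text \<open>Second-order Taylor formula with Lagrange remainder. Half of the exponent
  \<open>\<tau> * \<bar>t\<bar>\<close> absorbs the factor \<open>exp u\<close>, the other half
  absorbs \<open>t\<^sup>2\<close>.\<close>

lemma exp_quadratic_bound:
  fixes t \<epsilon> \<tau> :: real
  assumes "0 < \<epsilon>" "\<epsilon> \<le> \<tau> / 2"
  shows "exp (\<epsilon> * t) \<le> 1 + \<epsilon> * t + \<epsilon>\<^sup>2 * (4 / \<tau>\<^sup>2) * exp (\<tau> * \<bar>t\<bar>)"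
proof -
  have \<tau>: "\<tau> > 0" using assms by simp
  obtain u where u: "\<bar>u\<bar> \<le> \<bar>\<epsilon> * t\<bar>"
    and e: "exp (\<epsilon> * t) = (\<Sum>m<2. (\<epsilon> * t) ^ m / fact m) + exp u / fact 2 * (\<epsilon> * t)\<^sup>2"
    using Maclaurin_exp_le[of "\<epsilon> * t" 2] by blast
  have "u \<le> \<epsilon> * \<bar>t\<bar>" using u assms by (simp add: abs_mult)
  also have "\<dots> \<le> \<tau> / 2 * \<bar>t\<bar>" using assms by (intro mult_right_mono) auto
  finally have eu: "exp u \<le> exp (\<tau> / 2 * \<bar>t\<bar>)" by simp
  \<comment> \<open>This is \<open>y\<^sup>2 / 2 \<le> exp y\<close> at
    \<open>y = \<tau> / 2 * \<bar>t\<bar>\<close>, the source of the constant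
    \<open>8 / \<tau>\<^sup>2\<close>.\<close>
  have "(\<tau> / 2 * \<bar>t\<bar>)\<^sup>2 / 2 \<le> exp (\<tau> / 2 * \<bar>t\<bar>)"
    using exp_lower_Taylor_quadratic[of "\<tau> / 2 * \<bar>t\<bar>"] \<tau> by (smt (verit) mult_nonneg_nonneg abs_ge_zero divide_nonneg_nonneg)
  then have t2: "t\<^sup>2 \<le> 8 / \<tau>\<^sup>2 * exp (\<tau> / 2 * \<bar>t\<bar>)"
    using \<tau> by (simp add: field_simps power2_eq_square abs_mult_self_eq)
  have "exp u * t\<^sup>2 \<le> exp (\<tau> / 2 * \<bar>t\<bar>) * (8 / \<tau>\<^sup>2 * exp (\<tau> / 2 * \<bar>t\<bar>))"
    using eu t2 by (intro mult_mono) auto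
  also have "\<dots> = 8 / \<tau>\<^sup>2 * exp (\<tau> * \<bar>t\<bar>)"
    by (simp add: exp_add[symmetric] mult.left_commute)
  finally have "\<epsilon>\<^sup>2 / 2 * (exp u * t\<^sup>2) \<le> \<epsilon>\<^sup>2 / 2 * (8 / \<tau>\<^sup>2 * exp (\<tau> * \<bar>t\<bar>))"
    by (intro mult_left_mono) auto
  then show ?thesis using e by (simp add: numeral_2_eq_2 power_mult_distrib mult_ac)
qed

lemma abs_le_exp_abs:
  fixes t \<tau> :: real
  assumes "\<tau> > 0"
  shows "\<bar>t\<bar> \<le> exp (\<tau> * \<bar>t\<bar>) / \<tau>"
proof -
  have "\<bar>t\<bar> * \<tau> \<le> exp (\<tau> * \<bar>t\<bar>)"
    using exp_ge_add_one_self[of "\<tau> * \<bar>t\<bar>"] by (subst mult.commute) linarith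
  then show ?thesis using assms by (simp add: pos_le_divide_eq)
qed

section \<open>Submultiplicativity of moments on the space of increments\<close>

locale cocycle_walk = prob_space \<mu> for \<mu> :: "'g::semigroup_mult measure" +
  fixes act :: "'g \<Rightarrow> 'x \<Rightarrow> 'x" and s :: "'g \<Rightarrow> 'x \<Rightarrow> real"
  assumes cocycle: "additive_cocycle act s"
    and meas: "cocycle_measurable \<mu> s"
begin

abbreviation steps :: "nat \<Rightarrow> (nat \<Rightarrow> 'g) measure" where
  "steps n \<equiv> PiM {1..n} (\<lambda>_. \<mu>)"

text \<open>Values in \<open>ennreal\<close> allow the supremum and the integral to be formed before
  any finiteness is known.\<close>

definition sup_moment :: "(real \<Rightarrow> ennreal) \<Rightarrow> nat \<Rightarrow> ennreal" where
  "sup_moment \<phi> n = (SUP x. \<integral>\<^sup>+g. \<phi> (s (left_prod g n) x) \<partial>steps n)"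

lemma prob_space_steps: "prob_space (PiM I (\<lambda>_. \<mu>))"
  by (rule prob_space_PiM) unfold_locales

lemma measurable_cocycle:
  "n \<ge> 1 \<Longrightarrow> (\<lambda>g. s (left_prod g n) x) \<in> borel_measurable (steps n)"
  using meas by (simp add: cocycle_measurable_def)

lemma nn_integral_le_sup_moment:
  "(\<integral>\<^sup>+g. \<phi> (s (left_prod g n) x) \<partial>steps n) \<le> sup_moment \<phi> n"
  unfolding sup_moment_def by (rule SUP_upper) simp

text \<open>After the first \<open>m\<close> increments the walk restarts from
  \<open>act (left_prod g m) x\<close>. The remaining \<open>n\<close> increments are independent of
  the past, and the supremum over starting points bounds their contribution whatever the new point
  is.\<close>

lemma sup_moment_add:
  assumes mn: "m \<ge> 1" "n \<ge> 1"
    and \<phi>[measurable]: "\<phi> \<in> borel_measurable borel"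
    and sub: "\<And>a b. \<phi> (a + b) \<le> \<phi> a * \<phi> b"
  shows "sup_moment \<phi> (m + n) \<le> sup_moment \<phi> m * sup_moment \<phi> n"
  unfolding sup_moment_def[of _ "m + n"]
proof (rule SUP_least)
  fix x
  let ?J = "{m + 1..m + n}"
  \<comment> \<open>Relabels the last \<open>n\<close> increments by \<open>{1..n}\<close>; since
    the increments are i.i.d. this carries their law to \<open>steps n\<close>.\<close>
  let ?shift = "\<lambda>h. \<lambda>i\<in>{1..n}. h (m + i)"
  interpret P: product_sigma_finite "\<lambda>_::nat. \<mu>" by unfold_locales
  have un: "{1..m + n} = {1..m} \<union> ?J" using mn by auto
  have f[measurable]: "(\<lambda>g. s (left_prod g (m + n)) x) \<in> borel_measurable (PiM ({1..m} \<union> ?J) (\<lambda>_. \<mu>))"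
    using measurable_cocycle[of "m + n" x] mn unfolding un by simp
  have shift[measurable]: "?shift \<in> PiM ?J (\<lambda>_. \<mu>) \<rightarrow>\<^sub>M steps n"
    by (intro measurable_restrict measurable_component_singleton) auto
  have distr_shift: "distr (PiM ?J (\<lambda>_. \<mu>)) (steps n) ?shift = steps n"
    using distr_PiM_reindex[of ?J "\<lambda>_. \<mu>" "\<lambda>i. m + i" "{1..n}"] prob_space_axioms
    by (simp add: comp_def inj_on_def Pi_iff)
  \<comment> \<open>Here \<open>g\<close> is the fixed past and \<open>h\<close> the future. With
    \<open>g\<close> fixed, \<open>?y\<close> is a single point, so the factor
    \<open>sup_moment \<phi> n\<close> is the same for every \<open>g\<close>.\<close>
  have inner: "(\<integral>\<^sup>+h. \<phi> (s (left_prod (merge {1..m} ?J (g, h)) (m + n)) x) \<partial>PiM ?J (\<lambda>_. \<mu>))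
      \<le> \<phi> (s (left_prod g m) x) * sup_moment \<phi> n" for g
  proof -
    let ?y = "act (left_prod g m) x"
    note [measurable] = measurable_cocycle[OF mn(2), of ?y]
    have prod: "left_prod (merge {1..m} ?J (g, h)) (m + n)
        = left_prod (?shift h) n * left_prod g m" for h
    proof -
      have "left_prod (\<lambda>i. merge {1..m} ?J (g, h) (m + i)) n = left_prod (?shift h) n"
        using mn by (intro left_prod_cong) (auto simp: merge_def)
      moreover have "left_prod (merge {1..m} ?J (g, h)) m = left_prod g m"
        using mn by (intro left_prod_cong) (auto simp: merge_def)
      ultimately show ?thesis by (simp add: left_prod_add[OF mn])
    qed
    have "(\<integral>\<^sup>+h. \<phi> (s (left_prod (merge {1..m} ?J (g, h)) (m + n)) x) \<partial>PiM ?J (\<lambda>_. \<mu>))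
        \<le> (\<integral>\<^sup>+h. \<phi> (s (left_prod g m) x) * \<phi> (s (left_prod (?shift h) n) ?y) \<partial>PiM ?J (\<lambda>_. \<mu>))"
      unfolding prod using cocycle sub
      by (intro nn_integral_mono) (metis additive_cocycle_def add.commute)
    also have "\<dots> = \<phi> (s (left_prod g m) x)
        * (\<integral>\<^sup>+h. \<phi> (s (left_prod (?shift h) n) ?y) \<partial>PiM ?J (\<lambda>_. \<mu>))"
      by (intro nn_integral_cmult) measurable
    also have "(\<integral>\<^sup>+h. \<phi> (s (left_prod (?shift h) n) ?y) \<partial>PiM ?J (\<lambda>_. \<mu>))
        = (\<integral>\<^sup>+h. \<phi> (s (left_prod h n) ?y) \<partial>distr (PiM ?J (\<lambda>_. \<mu>)) (steps n) ?shift)"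
      by (subst nn_integral_distr) measurable
    also have "\<dots> \<le> sup_moment \<phi> n"
      unfolding distr_shift by (rule nn_integral_le_sup_moment)
    finally show ?thesis by (simp add: mult_left_mono)
  qed
  note [measurable] = measurable_cocycle[OF mn(1)]
  \<comment> \<open>Tonelli for the two disjoint blocks of indices.\<close>
  have "(\<integral>\<^sup>+g. \<phi> (s (left_prod g (m + n)) x) \<partial>steps (m + n))
      = (\<integral>\<^sup>+g. \<integral>\<^sup>+h. \<phi> (s (left_prod (merge {1..m} ?J (g, h)) (m + n)) x) \<partial>PiM ?J (\<lambda>_. \<mu>) \<partial>steps m)"
    unfolding un by (intro P.product_nn_integral_fold) (auto intro: measurable_compose[OF f \<phi>])
  also have "\<dots> \<le> (\<integral>\<^sup>+g. \<phi> (s (left_prod g m) x) * sup_moment \<phi> n \<partial>steps m)"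
    by (intro nn_integral_mono inner)
  also have "\<dots> = (\<integral>\<^sup>+g. \<phi> (s (left_prod g m) x) \<partial>steps m) * sup_moment \<phi> n"
    by (intro nn_integral_multc) measurable
  also have "\<dots> \<le> sup_moment \<phi> m * sup_moment \<phi> n"
    by (intro mult_right_mono nn_integral_le_sup_moment) simp
  finally show "(\<integral>\<^sup>+g. \<phi> (s (left_prod g (m + n)) x) \<partial>steps (m + n)) \<le> sup_moment \<phi> m * sup_moment \<phi> n" .
qed

text \<open>The remainder satisfies \<open>r \<ge> 1\<close> because the empty product is undefined;
  Euclidean division is therefore used with remainders in \<open>{1..p}\<close>.\<close>

lemma sup_moment_mult_add:
  assumes "p \<ge> 1" "r \<ge> 1"
    and "\<phi> \<in> borel_measurable borel" "\<And>a b. \<phi> (a + b) \<le> \<phi> a * \<phi> b"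
  shows "sup_moment \<phi> (q * p + r) \<le> sup_moment \<phi> p ^ q * sup_moment \<phi> r"
proof (induction q)
  case (Suc q)
  have "sup_moment \<phi> (p + (q * p + r)) \<le> sup_moment \<phi> p * sup_moment \<phi> (q * p + r)"
    using assms by (intro sup_moment_add) auto
  also have "\<dots> \<le> sup_moment \<phi> p * (sup_moment \<phi> p ^ q * sup_moment \<phi> r)"
    using Suc.IH by (intro mult_left_mono) auto
  finally show ?case by (simp add: mult_ac add_ac)
qed simp

end

section \<open>Exponential moments and drift\<close>

text \<open>\<open>K_ge_1\<close> is no loss, as \<open>K\<close> can be enlarged, and makes
  \<open>K ^ n\<close> increasing in \<open>n\<close>.\<close>

locale exponential_cocycle_walk = cocycle_walk +
  fixes \<tau> K :: real
  assumes \<tau>_pos: "\<tau> > 0"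
    and K: "sup_moment (\<lambda>t. ennreal (exp (\<tau> * \<bar>t\<bar>))) 1 \<le> ennreal K" and K_ge_1: "K \<ge> 1"
begin

lemma sup_exp_abs_moment_le:
  assumes "n \<ge> 1"
  shows "sup_moment (\<lambda>t. ennreal (exp (\<tau> * \<bar>t\<bar>))) n \<le> ennreal (K ^ n)"
proof -
  \<comment> \<open>Submultiplicative by the triangle inequality, so the one-step bound
    \<open>K\<close> can be iterated.\<close>
  let ?\<phi> = "\<lambda>t::real. ennreal (exp (\<tau> * \<bar>t\<bar>))"
  have sub: "?\<phi> (a + b) \<le> ?\<phi> a * ?\<phi> b" for a b
  proof -
    have "\<tau> * \<bar>a + b\<bar> \<le> \<tau> * (\<bar>a\<bar> + \<bar>b\<bar>)" using \<tau>_pos by (intro mult_left_mono) auto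
    then show ?thesis
      by (simp add: ennreal_mult'[symmetric] exp_add[symmetric] distrib_left)
  qed
  obtain q where q: "n = q * 1 + 1" using assms by (metis add.commute le_Suc_ex mult.right_neutral)
  have "sup_moment ?\<phi> n \<le> sup_moment ?\<phi> 1 ^ q * sup_moment ?\<phi> 1"
    unfolding q by (rule sup_moment_mult_add) (use sub in auto)
  also have "\<dots> \<le> ennreal K ^ q * ennreal K"
    using K by (intro mult_mono power_mono) auto
  also have "\<dots> = ennreal (K ^ n)"
    using K_ge_1 q by (simp add: ennreal_power ennreal_mult'[symmetric] power_add)
  finally show ?thesis .
qed

text \<open>A Bochner integral defaults to 0 without integrability, and a real \<open>SUP\<close>
  says something only for a set bounded above. These facts, with bounds uniform in \<open>x\<close>,
  give the expectations and their supremum the intended meaning.\<close>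

lemma cocycle_integrability:
  assumes "n \<ge> 1"
  shows integrable_exp_abs: "integrable (steps n) (\<lambda>g. exp (\<tau> * \<bar>s (left_prod g n) x\<bar>))"
    and integral_exp_abs_le: "(\<integral>g. exp (\<tau> * \<bar>s (left_prod g n) x\<bar>) \<partial>steps n) \<le> K ^ n"
    and integrable_cocycle: "integrable (steps n) (\<lambda>g. s (left_prod g n) x)"
    and integral_cocycle_le: "(\<integral>g. s (left_prod g n) x \<partial>steps n) \<le> K ^ n / \<tau>"
proof -
  note [measurable] = measurable_cocycle[OF assms, of x]
  have nn: "(\<integral>\<^sup>+g. ennreal (exp (\<tau> * \<bar>s (left_prod g n) x\<bar>)) \<partial>steps n) \<le> ennreal (K ^ n)"
    using nn_integral_le_sup_moment sup_exp_abs_moment_le[OF assms] by (rule order_trans)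
  then show i: "integrable (steps n) (\<lambda>g. exp (\<tau> * \<bar>s (left_prod g n) x\<bar>))"
    by (intro integrableI_nonneg) (auto simp: le_less_trans[OF _ ennreal_less_top])
  show e: "(\<integral>g. exp (\<tau> * \<bar>s (left_prod g n) x\<bar>) \<partial>steps n) \<le> K ^ n"
    using nn K_ge_1 by (subst (asm) nn_integral_eq_integral[OF i]) auto
  show j: "integrable (steps n) (\<lambda>g. s (left_prod g n) x)"
    by (rule Bochner_Integration.integrable_bound[OF integrable_divide_zero[OF i, of \<tau>]])
      (use abs_le_exp_abs[OF \<tau>_pos] \<tau>_pos in auto)
  have "(\<integral>g. s (left_prod g n) x \<partial>steps n) \<le> (\<integral>g. exp (\<tau> * \<bar>s (left_prod g n) x\<bar>) / \<tau> \<partial>steps n)"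
    by (intro integral_mono j integrable_divide_zero i)
      (use abs_le_exp_abs[OF \<tau>_pos] in \<open>auto intro: order_trans[OF abs_ge_self]\<close>)
  also have "\<dots> \<le> K ^ n / \<tau>" using e \<tau>_pos by (simp add: divide_right_mono)
  finally show "(\<integral>g. s (left_prod g n) x \<partial>steps n) \<le> K ^ n / \<tau>" .
qed

text \<open>Integrating the quadratic bound gives \<open>1 + y\<close>, and
  \<open>1 + y \<le> exp y\<close> puts it in a form suited to taking powers.\<close>

lemma sup_exp_moment_quadratic:
  assumes n: "n \<ge> 1" and \<epsilon>: "0 < \<epsilon>" "\<epsilon> \<le> \<tau> / 2"
    and a: "\<And>x. (\<integral>g. s (left_prod g n) x \<partial>steps n) \<le> a"
  shows "sup_moment (\<lambda>t. ennreal (exp (\<epsilon> * t))) n \<le> ennreal (exp (\<epsilon> * (a + \<epsilon> * (4 / \<tau>\<^sup>2 * K ^ n))))"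
  unfolding sup_moment_def
proof (rule SUP_least)
  fix x
  let ?s = "\<lambda>g. s (left_prod g n) x"
  let ?f = "\<lambda>g. 1 + \<epsilon> * ?s g + \<epsilon>\<^sup>2 * (4 / \<tau>\<^sup>2) * exp (\<tau> * \<bar>?s g\<bar>)"
  interpret Q: prob_space "steps n" by (rule prob_space_steps)
  note i = integrable_exp_abs[OF n, of x] integrable_cocycle[OF n, of x]
  have f: "exp (\<epsilon> * ?s g) \<le> ?f g" for g
    by (rule exp_quadratic_bound[OF \<epsilon>])
  have f0: "0 \<le> ?f g" for g
    by (rule order_trans[OF _ f]) simp
  have fi: "integrable (steps n) ?f" using i by simp
  have "(\<integral>g. ?f g \<partial>steps n)
      = 1 + \<epsilon> * (\<integral>g. ?s g \<partial>steps n) + \<epsilon>\<^sup>2 * (4 / \<tau>\<^sup>2) * (\<integral>g. exp (\<tau> * \<bar>?s g\<bar>) \<partial>steps n)"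
    using i by (simp add: Q.prob_space)
  also have "\<dots> \<le> 1 + \<epsilon> * a + \<epsilon>\<^sup>2 * (4 / \<tau>\<^sup>2) * K ^ n"
    using a[of x] integral_exp_abs_le[OF n, of x] \<epsilon> by (intro add_mono mult_left_mono) auto
  also have "\<dots> = 1 + \<epsilon> * (a + \<epsilon> * (4 / \<tau>\<^sup>2 * K ^ n))"
    by (simp add: power2_eq_square algebra_simps)
  also have "\<dots> \<le> exp (\<epsilon> * (a + \<epsilon> * (4 / \<tau>\<^sup>2 * K ^ n)))" by (rule exp_ge_add_one_self)
  finally have "ennreal (\<integral>g. ?f g \<partial>steps n) \<le> ennreal (exp (\<epsilon> * (a + \<epsilon> * (4 / \<tau>\<^sup>2 * K ^ n))))"
    by (rule ennreal_leI)
  moreover have "(\<integral>\<^sup>+g. ennreal (exp (\<epsilon> * ?s g)) \<partial>steps n) \<le> (\<integral>\<^sup>+g. ennreal (?f g) \<partial>steps n)"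
    by (intro nn_integral_mono ennreal_leI f)
  moreover have "(\<integral>\<^sup>+g. ennreal (?f g) \<partial>steps n) = ennreal (\<integral>g. ?f g \<partial>steps n)"
    using fi f0 by (intro nn_integral_eq_integral) auto
  ultimately show "(\<integral>\<^sup>+g. ennreal (exp (\<epsilon> * ?s g)) \<partial>steps n)
      \<le> ennreal (exp (\<epsilon> * (a + \<epsilon> * (4 / \<tau>\<^sup>2 * K ^ n))))"
    by (simp only: order_trans)
qed

text \<open>The gap between \<open>a / p\<close> and \<open>c\<close> is split at \<open>b\<close>:
  small \<open>\<epsilon>\<close> makes the second-order term fit below \<open>b\<close>, and large
  \<open>n\<close> makes the remainder block fit between \<open>b\<close> and \<open>c\<close>.
  Every exponent carries the factor \<open>\<epsilon>\<close>, so \<open>n\<^sub>0\<close> can be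
  chosen independently of \<open>\<epsilon>\<close>.\<close>

lemma sup_exp_moment_drift:
  assumes p: "p \<ge> 1" and drift: "(SUP x. \<integral>g. s (left_prod g p) x \<partial>steps p) < c * real p"
  obtains \<epsilon>\<^sub>0 n\<^sub>0 where "\<epsilon>\<^sub>0 > 0" "n\<^sub>0 \<ge> (1::nat)"
    "\<And>\<epsilon> n. 0 < \<epsilon> \<Longrightarrow> \<epsilon> < \<epsilon>\<^sub>0 \<Longrightarrow> n > n\<^sub>0 \<Longrightarrow>
      sup_moment (\<lambda>t. ennreal (exp (\<epsilon> * t))) n \<le> ennreal (exp (\<epsilon> * c) ^ n)"
proof -
  define a where "a = (SUP x. \<integral>g. s (left_prod g p) x \<partial>steps p)"
  define b where "b = (a / p + c) / 2"
  define D where "D = 4 / \<tau>\<^sup>2 * K ^ p"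
  \<comment> \<open>First- and second-order bounds for a block of any length
    \<open>r \<le> p\<close>, uniform over \<open>\<epsilon> \<le> \<tau> / 2\<close>.\<close>
  define A where "A = K ^ p / \<tau> + \<tau> / 2 * D"
  have p0: "real p > 0" using p by simp
  have ap: "a < c * p" using drift by (simp add: a_def)
  have bc: "b < c" and ab: "a < b * p" using ap p0 by (auto simp: b_def field_simps)
  have D0: "D > 0" using K_ge_1 \<tau>_pos by (simp add: D_def)
  have le_a: "(\<integral>g. s (left_prod g p) x \<partial>steps p) \<le> a" for x
    unfolding a_def using integral_cocycle_le[OF p] by (intro cSUP_upper bdd_aboveI2) auto
  \<comment> \<open>The first entry keeps the Taylor bound valid, the second gives
    \<open>a + \<epsilon> * D \<le> b * p\<close>.\<close>
  define \<epsilon>\<^sub>0 where "\<epsilon>\<^sub>0 = min (\<tau> / 2) ((b * p - a) / D)"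
  have e0: "\<epsilon>\<^sub>0 > 0" using \<tau>_pos D0 ab by (simp add: \<epsilon>\<^sub>0_def)
  \<comment> \<open>Chosen so that \<open>n > n\<^sub>0\<close> gives
    \<open>p * \<bar>b\<bar> + A \<le> n * (c - b)\<close>.\<close>
  define n\<^sub>0 where "n\<^sub>0 = max 1 (nat \<lceil>(p * \<bar>b\<bar> + A) / (c - b)\<rceil>)"
  show ?thesis
  proof (rule that[of \<epsilon>\<^sub>0 n\<^sub>0])
    fix \<epsilon> :: real and n :: nat
    assume \<epsilon>: "0 < \<epsilon>" "\<epsilon> < \<epsilon>\<^sub>0" and n: "n > n\<^sub>0"
    let ?F = "sup_moment (\<lambda>t. ennreal (exp (\<epsilon> * t)))"
    have \<epsilon>\<tau>: "\<epsilon> \<le> \<tau> / 2" and \<epsilon>D: "\<epsilon> * D \<le> b * p - a"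
      using \<epsilon> D0 by (auto simp: \<epsilon>\<^sub>0_def field_simps)
    \<comment> \<open>Dividing \<open>n - 1\<close> instead of \<open>n\<close> puts the remainder
      \<open>r\<close> in \<open>{1..p}\<close>.\<close>
    define q r where "q = (n - 1) div p" and "r = (n - 1) mod p + 1"
    have n_eq: "n = q * p + r" using n by (simp add: q_def r_def n\<^sub>0_def)
    have r: "r \<ge> 1" "r \<le> p" using p mod_less_divisor[of p "n - 1"] unfolding r_def by linarith+
    have Fp: "?F p \<le> ennreal (exp (\<epsilon> * (b * p)))"
    proof -
      have "?F p \<le> ennreal (exp (\<epsilon> * (a + \<epsilon> * D)))"
        unfolding D_def by (rule sup_exp_moment_quadratic[OF p \<epsilon>(1) \<epsilon>\<tau> le_a])
      also have "\<dots> \<le> ennreal (exp (\<epsilon> * (b * p)))"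
        using \<epsilon>D \<epsilon> by (intro ennreal_leI) simp
      finally show ?thesis .
    qed
    have Fr: "?F r \<le> ennreal (exp (\<epsilon> * A))"
    proof -
      have Kr: "K ^ r \<le> K ^ p" using K_ge_1 r by (intro power_increasing)
      have "?F r \<le> ennreal (exp (\<epsilon> * (K ^ r / \<tau> + \<epsilon> * (4 / \<tau>\<^sup>2 * K ^ r))))"
        by (rule sup_exp_moment_quadratic[OF r(1) \<epsilon>(1) \<epsilon>\<tau> integral_cocycle_le[OF r(1)]])
      also have "\<dots> \<le> ennreal (exp (\<epsilon> * A))"
      proof -
        have "K ^ r / \<tau> + \<epsilon> * (4 / \<tau>\<^sup>2 * K ^ r) \<le> A"
          unfolding A_def D_def using Kr \<epsilon>\<tau> \<tau>_pos K_ge_1 \<epsilon>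
          by (intro add_mono mult_mono divide_right_mono) auto
        then show ?thesis using \<epsilon> by (intro ennreal_leI) simp
      qed
      finally show ?thesis .
    qed
    have "?F n \<le> ?F p ^ q * ?F r"
      unfolding n_eq using p r
      by (intro sup_moment_mult_add) (auto simp: ennreal_mult'[symmetric] exp_add[symmetric] distrib_left)
    also have "\<dots> \<le> ennreal (exp (\<epsilon> * (b * p))) ^ q * ennreal (exp (\<epsilon> * A))"
      by (intro mult_mono power_mono Fp Fr) auto
    also have "\<dots> = ennreal (exp (\<epsilon> * (q * p * b + A)))"
      by (simp add: ennreal_power ennreal_mult'[symmetric] exp_of_nat_mult[symmetric] exp_add[symmetric]
          algebra_simps)
    also have "\<dots> \<le> ennreal (exp (\<epsilon> * (n * c)))"
    proof -
      have "real n > (p * \<bar>b\<bar> + A) / (c - b)" using n by (simp add: n\<^sub>0_def) linarith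
      then have "p * \<bar>b\<bar> + A \<le> n * (c - b)" using bc by (simp add: field_simps)
      \<comment> \<open>The full blocks contribute \<open>q * p * b = n * b - r * b\<close>, and the
        sign of \<open>b\<close> is not known.\<close>
      moreover have "- (r * b) \<le> p * \<bar>b\<bar>"
      proof -
        have "- (r * b) \<le> r * \<bar>b\<bar>" by (metis abs_ge_minus_self abs_mult abs_of_nat)
        also have "\<dots> \<le> p * \<bar>b\<bar>" using r by (intro mult_right_mono) auto
        finally show ?thesis .
      qed
      moreover have "real n * b = q * p * b + r * b" unfolding n_eq by (simp add: algebra_simps)
      ultimately have "q * p * b + A \<le> n * c" by (simp add: algebra_simps)
      then show ?thesis using \<epsilon> by (intro ennreal_leI) simp
    qed
    also have "\<dots> = ennreal (exp (\<epsilon> * c) ^ n)"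
      by (simp add: exp_of_nat_mult[symmetric] mult_ac)
    finally show "?F n \<le> ennreal (exp (\<epsilon> * c) ^ n)" .
  qed (use e0 in \<open>auto simp: n\<^sub>0_def\<close>)
qed

end

text \<open>Both sides equal 1 at \<open>\<epsilon> = 0\<close>, where their derivatives are
  \<open>c < d\<close>.\<close>

lemma exp_le_affine_at_right_0:
  fixes c d :: real
  assumes "c < d"
  obtains \<delta> where "\<delta> > 0" "\<And>\<epsilon>. 0 < \<epsilon> \<Longrightarrow> \<epsilon> < \<delta> \<Longrightarrow> exp (\<epsilon> * c) \<le> 1 + \<epsilon> * d"
proof -
  have "((\<lambda>\<epsilon>. 1 + \<epsilon> * d - exp (\<epsilon> * c)) has_real_derivative d - c) (at 0)"
    by (auto intro!: derivative_eq_intros)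
  from DERIV_pos_inc_right[OF this] assms obtain \<delta> where
    "\<delta> > 0" and "\<And>h. 0 < h \<Longrightarrow> h < \<delta> \<Longrightarrow> 0 < 1 + h * d - exp (h * c)" by auto
  then show ?thesis by (intro that[of \<delta>]) (auto simp: less_imp_le)
qed

section \<open>Transfer to the random walk and conclusion\<close>

theorem lemma4p12:
  fixes act :: "'g::semigroup_mult \<Rightarrow> 'x \<Rightarrow> 'x"
    and s :: "'g \<Rightarrow> 'x \<Rightarrow> real"
    and \<mu> :: "'g measure"
    and M :: "'w measure"
    and X :: "nat \<Rightarrow> 'w \<Rightarrow> 'g"
    and S :: "nat \<Rightarrow> 'w \<Rightarrow> 'g"
    and \<tau> :: real
  assumes "semigroup_action act"
    and "additive_cocycle act s"
    and "prob_space \<mu>" and "space \<mu> = UNIV"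
    and "cocycle_measurable \<mu> s"
    and "prob_space M"
    and "prob_space.indep_vars M (\<lambda>_. \<mu>) X {1..}"
    and "\<And>i. i \<ge> 1 \<Longrightarrow> distr M \<mu> (X i) = \<mu>"
    and "\<And>n \<omega>. S n \<omega> = left_prod (\<lambda>i. X i \<omega>) n"
    and "\<tau> > 0"
    and "(\<integral>\<^sup>+\<omega>. exp_ennreal (ennreal \<tau> * cocycle_sup s (X 1 \<omega>)) \<partial>M) < \<infinity>"
  shows
    "((\<exists>L<0. (\<lambda>n. 1 / real n * (SUP x. prob_space.expectation M (\<lambda>\<omega>. s (S n \<omega>) x))) \<longlonglongrightarrow> L) \<longrightarrow>
        (\<exists>l>0. \<exists>\<epsilon>\<^sub>0>0. \<exists>n\<^sub>0\<ge>1. \<forall>\<epsilon> n. 0 < \<epsilon> \<and> \<epsilon> < \<epsilon>\<^sub>0 \<and> n > n\<^sub>0 \<longrightarrow>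
          (SUP x. \<integral>\<^sup>+\<omega>. ennreal (exp (\<epsilon> * s (S n \<omega>) x)) \<partial>M) \<le> ennreal ((1 - \<epsilon> * l) ^ n)))
     \<and>
     ((\<lambda>n. 1 / real n * (SUP x. prob_space.expectation M (\<lambda>\<omega>. s (S n \<omega>) x))) \<longlonglongrightarrow> 0 \<longrightarrow>
        (\<forall>\<gamma>>0. \<exists>\<epsilon>\<^sub>\<gamma>>0. \<exists>n\<^sub>\<gamma>\<ge>1. \<forall>\<epsilon> n. 0 < \<epsilon> \<and> \<epsilon> < \<epsilon>\<^sub>\<gamma> \<and> n > n\<^sub>\<gamma> \<longrightarrow>
          (SUP x. \<integral>\<^sup>+\<omega>. ennreal (exp (\<epsilon> * s (S n \<omega>) x)) \<partial>M) \<le> ennreal ((1 + \<epsilon> * \<gamma>) ^ n)))"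
proof -
  interpret M: prob_space M by fact
  interpret W: cocycle_walk \<mu> act s
    using assms(2,3,5) by (simp add: cocycle_walk_def cocycle_walk_axioms_def)
  let ?\<Pi> = "\<lambda>n. PiM {1..n} (\<lambda>_. \<mu>)"
  let ?X = "\<lambda>n \<omega>. \<lambda>i\<in>{1..n}. X i \<omega>"
  have X[measurable]: "X i \<in> M \<rightarrow>\<^sub>M \<mu>" if "i \<ge> 1" for i
    using assms(7) that by (auto simp: M.indep_vars_def)
  have Xn: "?X n \<in> M \<rightarrow>\<^sub>M ?\<Pi> n" for n
    by (intro measurable_restrict X) auto
  \<comment> \<open>Independence makes the joint law a product, and each factor is
    \<open>\<mu>\<close>. Hence integrals over \<open>M\<close> become integrals over the space of
    increments.\<close>
  have law: "distr M (?\<Pi> n) (?X n) = ?\<Pi> n" if n: "n \<ge> 1" for n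
  proof -
    have "M.indep_vars (\<lambda>_. \<mu>) X {1..n}"
      by (rule M.indep_vars_subset[OF assms(7)]) auto
    then have "distr M (?\<Pi> n) (?X n) = PiM {1..n} (\<lambda>i. distr M \<mu> (X i))"
      by (subst (asm) M.indep_vars_iff_distr_eq_PiM') (use n X in auto)
    also have "\<dots> = ?\<Pi> n" using assms(8) by (intro PiM_cong) auto
    finally show ?thesis .
  qed
  have S: "S n \<omega> = left_prod (?X n \<omega>) n" if "n \<ge> 1" for n \<omega>
    unfolding assms(9) using that by (intro left_prod_cong) auto
  have nn: "(\<integral>\<^sup>+\<omega>. \<phi> (s (S n \<omega>) x) \<partial>M) = (\<integral>\<^sup>+g. \<phi> (s (left_prod g n) x) \<partial>?\<Pi> n)"
    if "n \<ge> 1" and [measurable]: "\<phi> \<in> borel_measurable borel" for \<phi> :: "real \<Rightarrow> ennreal" and n x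
  proof -
    note [measurable] = W.measurable_cocycle[OF that(1), of x]
    show ?thesis
      by (subst law[OF that(1), symmetric]) (simp add: nn_integral_distr Xn S that(1))
  qed
  have ex: "(\<integral>\<omega>. s (S n \<omega>) x \<partial>M) = (\<integral>g. s (left_prod g n) x \<partial>?\<Pi> n)" if "n \<ge> 1" for n x
    by (subst law[OF that, symmetric])
      (simp add: integral_distr Xn S that W.measurable_cocycle)
  have sm: "(SUP x. \<integral>\<^sup>+\<omega>. ennreal (exp (\<epsilon> * s (S n \<omega>) x)) \<partial>M)
      = W.sup_moment (\<lambda>t. ennreal (exp (\<epsilon> * t))) n" if "n \<ge> 1" for \<epsilon> n
    unfolding W.sup_moment_def using nn[OF that, of "\<lambda>t. ennreal (exp (\<epsilon> * t))"] by simp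
  define I where "I = (\<integral>\<^sup>+\<omega>. exp_ennreal (ennreal \<tau> * cocycle_sup s (X 1 \<omega>)) \<partial>M)"
  have "W.sup_moment (\<lambda>t. ennreal (exp (\<tau> * \<bar>t\<bar>))) 1 \<le> I"
    unfolding W.sup_moment_def I_def
  proof (rule SUP_least)
    fix x
    \<comment> \<open>Where the supremum is infinite the right side is infinite; elsewhere
      \<open>enn2real\<close> is monotone below a finite bound.\<close>
    have "ennreal (exp (\<tau> * \<bar>s g x\<bar>)) \<le> exp_ennreal (ennreal \<tau> * cocycle_sup s g)" for g
    proof (cases "ennreal \<tau> * cocycle_sup s g = \<infinity>")
      case False
      have "ennreal (\<tau> * \<bar>s g x\<bar>) \<le> ennreal \<tau> * cocycle_sup s g"
        unfolding cocycle_sup_def using \<open>\<tau> > 0\<close>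
        by (subst ennreal_mult') (auto intro!: mult_left_mono SUP_upper)
      then have "enn2real (ennreal (\<tau> * \<bar>s g x\<bar>)) \<le> enn2real (ennreal \<tau> * cocycle_sup s g)"
        using False by (intro enn2real_mono) (auto simp: less_top)
      then show ?thesis using False \<open>\<tau> > 0\<close> by (simp add: exp_ennreal_def)
    qed (simp add: exp_ennreal_def)
    then have "(\<integral>\<^sup>+\<omega>. ennreal (exp (\<tau> * \<bar>s (S 1 \<omega>) x\<bar>)) \<partial>M)
        \<le> (\<integral>\<^sup>+\<omega>. exp_ennreal (ennreal \<tau> * cocycle_sup s (X 1 \<omega>)) \<partial>M)"
      unfolding assms(9) by (intro nn_integral_mono) simp
    then show "(\<integral>\<^sup>+g. ennreal (exp (\<tau> * \<bar>s (left_prod g 1) x\<bar>)) \<partial>?\<Pi> 1)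
        \<le> (\<integral>\<^sup>+\<omega>. exp_ennreal (ennreal \<tau> * cocycle_sup s (X 1 \<omega>)) \<partial>M)"
      using nn[of 1 "\<lambda>t. ennreal (exp (\<tau> * \<bar>t\<bar>))" x] by simp
  qed
  also have "I \<le> ennreal (max 1 (enn2real I))"
    using assms(11) by (cases I) (auto simp: I_def[symmetric])
  finally interpret E: exponential_cocycle_walk \<mu> act s \<tau> "max 1 (enn2real I)"
    using assms(10) by unfold_locales auto
  \<comment> \<open>Both parts at once: \<open>d\<close> is negative in the first and equals
    \<open>\<gamma>\<close> in the second.\<close>
  have main: "\<exists>\<epsilon>\<^sub>0>0. \<exists>n\<^sub>0\<ge>1. \<forall>\<epsilon> n. 0 < \<epsilon> \<and> \<epsilon> < \<epsilon>\<^sub>0 \<and> n > n\<^sub>0 \<longrightarrow>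
      (SUP x. \<integral>\<^sup>+\<omega>. ennreal (exp (\<epsilon> * s (S n \<omega>) x)) \<partial>M) \<le> ennreal ((1 + \<epsilon> * d) ^ n)"
    if lim: "(\<lambda>n. 1 / real n * (SUP x. M.expectation (\<lambda>\<omega>. s (S n \<omega>) x))) \<longlonglongrightarrow> L" and "L < d" for L d
  proof -
    \<comment> \<open>\<open>L < c\<close> leaves room to find a suitable \<open>p\<close>, and
      \<open>c < d\<close> room to replace \<open>exp (\<epsilon> * c)\<close> by
      \<open>1 + \<epsilon> * d\<close>.\<close>
    obtain c where c: "L < c" "c < d" using \<open>L < d\<close> dense by blast
    have "eventually (\<lambda>n. 1 / real n * (SUP x. M.expectation (\<lambda>\<omega>. s (S n \<omega>) x)) < c \<and> n \<ge> 1) sequentially"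
      using order_tendstoD(2)[OF lim c(1)] eventually_ge_at_top by (rule eventually_conj)
    then obtain p where p: "p \<ge> 1" "1 / real p * (SUP x. M.expectation (\<lambda>\<omega>. s (S p \<omega>) x)) < c"
      by (auto simp: eventually_sequentially)
    have "(SUP x. \<integral>g. s (left_prod g p) x \<partial>?\<Pi> p) < c * real p"
      using p by (simp add: ex field_simps)
    then obtain \<epsilon>\<^sub>1 n\<^sub>0 where e1: "\<epsilon>\<^sub>1 > 0" "n\<^sub>0 \<ge> (1::nat)"
      "\<And>\<epsilon> n. 0 < \<epsilon> \<Longrightarrow> \<epsilon> < \<epsilon>\<^sub>1 \<Longrightarrow> n > n\<^sub>0 \<Longrightarrow>
        W.sup_moment (\<lambda>t. ennreal (exp (\<epsilon> * t))) n \<le> ennreal (exp (\<epsilon> * c) ^ n)"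
      by (rule E.sup_exp_moment_drift[OF p(1)]) blast
    \<comment> \<open>For such \<open>\<epsilon>\<close> the base \<open>1 + \<epsilon> * d\<close>
      is positive even if \<open>d < 0\<close>, so \<open>ennreal\<close> truncates nothing in the
      final bound.\<close>
    obtain \<delta> where d: "\<delta> > 0" "\<And>\<epsilon>. 0 < \<epsilon> \<Longrightarrow> \<epsilon> < \<delta> \<Longrightarrow> exp (\<epsilon> * c) \<le> 1 + \<epsilon> * d"
      using exp_le_affine_at_right_0[OF c(2)] by blast
    show ?thesis
    proof (intro exI[of _ "min \<epsilon>\<^sub>1 \<delta>"] exI[of _ n\<^sub>0] conjI allI impI)
      fix \<epsilon> :: real and n :: nat
      assume h: "0 < \<epsilon> \<and> \<epsilon> < min \<epsilon>\<^sub>1 \<delta> \<and> n > n\<^sub>0"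
      have "(SUP x. \<integral>\<^sup>+\<omega>. ennreal (exp (\<epsilon> * s (S n \<omega>) x)) \<partial>M) \<le> ennreal (exp (\<epsilon> * c) ^ n)"
        using e1 h by (subst sm) auto
      also have "\<dots> \<le> ennreal ((1 + \<epsilon> * d) ^ n)"
        using d h by (intro ennreal_leI power_mono) auto
      finally show "(SUP x. \<integral>\<^sup>+\<omega>. ennreal (exp (\<epsilon> * s (S n \<omega>) x)) \<partial>M) \<le> ennreal ((1 + \<epsilon> * d) ^ n)" .
    qed (use e1 d in auto)
  qed
  show ?thesis
  proof (intro conjI impI allI)
    assume "\<exists>L<0. (\<lambda>n. 1 / real n * (SUP x. M.expectation (\<lambda>\<omega>. s (S n \<omega>) x))) \<longlonglongrightarrow> L"
    then obtain L where L: "L < 0"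
      and lim: "(\<lambda>n. 1 / real n * (SUP x. M.expectation (\<lambda>\<omega>. s (S n \<omega>) x))) \<longlonglongrightarrow> L" by blast
    show "\<exists>l>0. \<exists>\<epsilon>\<^sub>0>0. \<exists>n\<^sub>0\<ge>1. \<forall>\<epsilon> n. 0 < \<epsilon> \<and> \<epsilon> < \<epsilon>\<^sub>0 \<and> n > n\<^sub>0 \<longrightarrow>
        (SUP x. \<integral>\<^sup>+\<omega>. ennreal (exp (\<epsilon> * s (S n \<omega>) x)) \<partial>M) \<le> ennreal ((1 - \<epsilon> * l) ^ n)"
      \<comment> \<open>Any \<open>d\<close> strictly between \<open>L\<close> and 0 would do;
        \<open>d = L / 2\<close> gives \<open>l = - L / 2\<close>.\<close>
      using main[OF lim, of "L / 2"] L by (intro exI[of _ "- L / 2"]) simp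
  next
    fix \<gamma> :: real
    assume "(\<lambda>n. 1 / real n * (SUP x. M.expectation (\<lambda>\<omega>. s (S n \<omega>) x))) \<longlonglongrightarrow> 0" and "\<gamma> > 0"
    then show "\<exists>\<epsilon>\<^sub>\<gamma>>0. \<exists>n\<^sub>\<gamma>\<ge>1. \<forall>\<epsilon> n. 0 < \<epsilon> \<and> \<epsilon> < \<epsilon>\<^sub>\<gamma> \<and> n > n\<^sub>\<gamma> \<longrightarrow>
        (SUP x. \<integral>\<^sup>+\<omega>. ennreal (exp (\<epsilon> * s (S n \<omega>) x)) \<partial>M) \<le> ennreal ((1 + \<epsilon> * \<gamma>) ^ n)"
      by (rule main)
  qed
qed

end
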